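(* Let $\Psi\in\mathbb{R}^{n\times p}$ have columns $\psi_1,\dots,\psi_p$ with $\|\psi_i\|=1$ for all $i$, let $y\in\mathbb{R}^n$, $\lambda>0$, let $\rho_{\lambda,\tau}$ be one of the penalties $\ell^0$, bridge, capped-$\ell^1$, SCAD, MCP, and let $J(x)=\frac12\|\Psi x-y\|^2+\sum_{i=1}^p\rho_{\lambda,\tau}(x_i)$. Let $x^*$ be a coordinate-wise minimizer of $J$, let $\mathcal{A}=\{i:x_i^*\neq0\}$ and $\mathcal{I}=\mathcal{A}^c$ be its active and inactive sets, let $d^*=\Psi^t(y-\Psi x^* )$, and let $\sigma(\mathcal{A})$ be the smallest singular value of $\Psi_{\mathcal{A}}^t\Psi_{\mathcal{A}}$. Then: (i) $\ell^0$: $x^*$ is a local minimizer of $J$. (ii) bridge: if $\sigma(\mathcal{A})>\frac{\tau}{2}$, then $x^*$ is a local minimizer of $J$. (iii) capped-$\ell^1$: if $\{i:|x_i^*|=\lambda\tau\}=\emptyset$, then $x^*$ is a local minimizer of $J$. (iv) SCAD: if $\sigma(\mathcal{A})>\frac{1}{\tau-1}$ and $\|d^*_{\mathcal{I}}\|_\infty<\lambda$, then $x^*$ is a local minimizer of $J$. (v) MCP: if $\sigma(\mathcal{A})>\frac1\tau$ and $\|d^*_{\mathcal{I}}\|_\infty<\lambda$, then $x^*$ is a local minimizer of $J$.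
   Context: $\|\cdot\|$ is the Euclidean norm and $\Psi^t$ the transpose. For $\mathcal{A}\subset\{1,\dots,p\}$, $x_{\mathcal{A}}$ is the subvector of $x$ with indices in $\mathcal{A}$, and $\Psi_{\mathcal{A}}$ the submatrix of $\Psi$ consisting of the columns with indices in $\mathcal{A}$; thus $\|\Psi_{\mathcal{A}}x_{\mathcal{A}}\|^2\ge\sigma(\mathcal{A})\|x_{\mathcal{A}}\|^2$. A vector $x^*$ is a coordinate-wise minimizer of $J$ if for every $i$, $x_i^*\in\operatorname{argmin}_{t\in\mathbb{R}}J(x_1^*,\dots,x_{i-1}^*,t,x_{i+1}^*,\dots,x_p^* )$. It is a local minimizer if $J(x^*+\omega)\ge J(x^* )$ for all sufficiently small $\omega\in\mathbb{R}^p$. For $\lambda>0$ the five nonconvex penalties $\rho=\rho_{\lambda,\tau}:\mathbb{R}\to[0,\infty)$ are: (1) $\ell^0$: $\rho(t)=\lambda$ if $t\neq0$, $\rho(0)=0$ (no parameter $\tau$). (2) bridge, $0<\tau<1$: $\rho(t)=\lambda|t|^\tau$. (3) capped-$\ell^1$, $\tau>\frac12$: $\rho(t)=\lambda^2\tau$ if $|t|>\lambda\tau$, and $\rho(t)=\lambda|t|$ if $|t|\le\lambda\tau$. (4) SCAD, $\tau>2$: $\rho(t)=\frac{\lambda^2(\tau+1)}{2}$ if $|t|>\lambda\tau$; $\rho(t)=\frac{\lambda\tau|t|-\frac12(t^2+\lambda^2)}{\tau-1}$ if $\lambda<|t|\le\lambda\tau$; $\rho(t)=\lambda|t|$ if $|t|\le\lambda$.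 (5) MCP, $\tau>1$: $\rho(t)=\lambda\left(|t|-\frac{t^2}{2\lambda\tau}\right)$ if $|t|<\tau\lambda$, and $\rho(t)=\frac{\lambda^2\tau}{2}$ if $|t|\ge\tau\lambda$. *)

theory Defs
  imports "HOL-Analysis.Analysis"
begin

definition pen_l0 :: "real \<Rightarrow> real \<Rightarrow> real" where
  "pen_l0 lam t = (if t \<noteq> 0 then lam else 0)"

definition pen_bridge :: "real \<Rightarrow> real \<Rightarrow> real \<Rightarrow> real" where
  "pen_bridge lam \<tau> t = lam * \<bar>t\<bar> powr \<tau>"

definition pen_capped :: "real \<Rightarrow> real \<Rightarrow> real \<Rightarrow> real" where
  "pen_capped lam \<tau> t = (if \<bar>t\<bar> > lam * \<tau> then lam\<^sup>2 * \<tau> else lam * \<bar>t\<bar>)"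

definition pen_scad :: "real \<Rightarrow> real \<Rightarrow> real \<Rightarrow> real" where
  "pen_scad lam \<tau> t =
     (if \<bar>t\<bar> > lam * \<tau> then lam\<^sup>2 * (\<tau> + 1) / 2
      else if \<bar>t\<bar> > lam then (lam * \<tau> * \<bar>t\<bar> - (t\<^sup>2 + lam\<^sup>2) / 2) / (\<tau> - 1)
      else lam * \<bar>t\<bar>)"

definition pen_mcp :: "real \<Rightarrow> real \<Rightarrow> real \<Rightarrow> real" where
  "pen_mcp lam \<tau> t =
     (if \<bar>t\<bar> < \<tau> * lam then lam * (\<bar>t\<bar> - t\<^sup>2 / (2 * lam * \<tau>)) else lam\<^sup>2 * \<tau> / 2)"

definition objective ::
  "real^'p^'n \<Rightarrow> real^'n \<Rightarrow> (real \<Rightarrow> real) \<Rightarrow> real^'p \<Rightarrow> real" where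
  "objective \<Psi> y \<rho> x = (norm (\<Psi> *v x - y))\<^sup>2 / 2 + (\<Sum>i\<in>UNIV. \<rho> (x $ i))"

definition coordinatewise_minimizer :: "(real^'p \<Rightarrow> real) \<Rightarrow> real^'p \<Rightarrow> bool" where
  "coordinatewise_minimizer J x \<longleftrightarrow>
     (\<forall>i. is_arg_min (\<lambda>t. J (\<chi> j. if j = i then t else x $ j)) (\<lambda>t. True) (x $ i))"

definition local_minimizer :: "(real^'p \<Rightarrow> real) \<Rightarrow> real^'p \<Rightarrow> bool" where
  "local_minimizer J x \<longleftrightarrow> (\<exists>\<delta>>0. \<forall>\<omega>. norm \<omega> < \<delta> \<longrightarrow> J (x + \<omega>) \<ge> J x)"

definition active_set :: "real^'p \<Rightarrow> 'p set" where
  "active_set x = {i. x $ i \<noteq> 0}"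

definition dual_vector :: "real^'p^'n \<Rightarrow> real^'n \<Rightarrow> real^'p \<Rightarrow> real^'p" where
  "dual_vector \<Psi> y x = transpose \<Psi> *v (y - \<Psi> *v x)"

text \<open>The maximum norm of the subvector with indices in \<open>I\<close>; the zero filling does not affect
  it, and the norm of the empty subvector is \<open>0\<close>.\<close>

definition infnorm_on :: "'p set \<Rightarrow> real^'p \<Rightarrow> real" where
  "infnorm_on I d = infnorm (\<chi> i. if i \<in> I then d $ i else 0)"

text \<open>The index set \<open>A\<close> depends on the minimizer, so it cannot be an index type. A matrix with
  rows in \<open>R\<close> and columns in \<open>A\<close> is a function of two indices of which only the values on
  \<open>R \<times> A\<close> are used. \<open>gram R M\<close> is the product of the transpose of \<open>M\<close> with \<open>M\<close>.\<close>

definition gram :: "'r set \<Rightarrow> ('r \<Rightarrow> 'c \<Rightarrow> real) \<Rightarrow> 'c \<Rightarrow> 'c \<Rightarrow> real" where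
  "gram R M = (\<lambda>j k. \<Sum>i\<in>R. M i j * M i k)"

definition eigenvalue_on :: "'c set \<Rightarrow> ('c \<Rightarrow> 'c \<Rightarrow> real) \<Rightarrow> real \<Rightarrow> bool" where
  "eigenvalue_on A M \<mu> \<longleftrightarrow>
     (\<exists>v. (\<exists>i\<in>A. v i \<noteq> 0) \<and> (\<forall>i\<in>A. (\<Sum>j\<in>A. M i j * v j) = \<mu> * v i))"

text \<open>Singular values of a square matrix with rows and columns in \<open>A\<close>: the square roots of the
  eigenvalues of its Gram matrix.\<close>

definition singular_values_on :: "'c set \<Rightarrow> ('c \<Rightarrow> 'c \<Rightarrow> real) \<Rightarrow> real set" where
  "singular_values_on A M = {s. s \<ge> 0 \<and> eigenvalue_on A (gram A M) (s\<^sup>2)}"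

text \<open>The infimum is over a finite set, nonempty unless \<open>A\<close> is empty. It is taken in the extended
  reals so that \<open>\<sigma>(\<emptyset>) = \<infinity>\<close>, consistently with
  \<open>\<parallel>\<Psi>\<^sub>A x\<^sub>A\<parallel>\<^sup>2 \<ge> \<sigma>(A) \<parallel>x\<^sub>A\<parallel>\<^sup>2\<close>, which holds for every constant if \<open>A\<close> is
  empty: a lower bound on \<open>\<sigma>(A)\<close> then excludes nothing.\<close>

definition smallest_sv :: "real^'p^'n \<Rightarrow> 'p set \<Rightarrow> ereal" where
  "smallest_sv \<Psi> A =
     (INF s \<in> singular_values_on A (gram UNIV (\<lambda>i j. \<Psi> $ i $ j)). ereal s)"

end

theory Submission
  imports Defs
begin

text \<open>
  The quadratic part of the objective is expanded exactly: moving from \<open>x\<close> to \<open>x + \<omega>\<close> changes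
  \<open>J\<close> by \<open>\<parallel>\<Psi> \<omega>\<parallel>\<^sup>2 / 2\<close> plus a sum over the coordinates of the excess
  \<open>e\<^sub>i(\<omega>\<^sub>i) = \<rho>(x\<^sub>i + \<omega>\<^sub>i) - \<rho>(x\<^sub>i) - d\<^sub>i \<omega>\<^sub>i\<close> (\<open>objective_add\<close>).
  Since the columns have norm \<open>1\<close>, coordinate-wise minimality says precisely that
  \<open>s\<^sup>2 / 2 + e\<^sub>i(s) \<ge> 0\<close> for all \<open>s\<close>. The coordinates interact only
  through \<open>\<parallel>\<Psi> \<omega>\<parallel>\<^sup>2\<close>, so all that is needed from a penalty is a sharp lower bound on each excess
  near \<open>0\<close>.

  For an active coordinate the bound comes from weak convexity: if \<open>\<rho>(u) + \<kappa> u\<^sup>2 / 2\<close> is convex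
  near \<open>x\<^sub>i\<close>, then \<open>e\<^sub>i(s) + \<kappa> s\<^sup>2 / 2\<close> is convex, vanishes at \<open>0\<close> and is bounded below by
  a multiple of \<open>- s\<^sup>2\<close>; such a function cannot be negative
  (\<open>excess_lower_bound_if_weakly_convex\<close>). This replaces the first-order conditions and
  applies equally at kinks of \<open>\<rho>\<close>. The constants are \<open>\<kappa> = 0\<close> for \<open>\<ell>\<^sup>0\<close> away from zero and for
  capped-\<open>\<ell>\<^sup>1\<close> off its knots, \<open>1 / (\<tau> - 1)\<close> for SCAD, \<open>1 / \<tau>\<close> for MCP, and any
  \<open>\<kappa> > \<tau> / 2\<close> for the bridge penalty. The last one uses the global comparison with the value
  \<open>0\<close> of the coordinate, which keeps an active coordinate so far from zero that
  \<open>\<rho>''(x\<^sub>i) \<ge> - \<tau> / 2\<close> (\<open>bridge_second_derivative_bound\<close>).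

  For \<open>\<ell>\<^sup>0\<close>, where the jump of \<open>\<rho>\<close> settles the inactive coordinates, and for capped-\<open>\<ell>\<^sup>1\<close> all
  excesses are therefore nonnegative near \<open>0\<close>, which suffices. For the other penalties an inactive
  coordinate contributes at least \<open>c \<bar>\<omega>\<^sub>i\<bar>\<close>, by the strict bound on \<open>d\<^sub>i\<close> or by the infinite slope of
  the bridge penalty at zero. The quadratic loss on the active block is absorbed by
  \<open>\<parallel>\<Psi>\<^sub>A \<omega>\<^sub>A\<parallel>\<^sup>2 \<ge> \<kappa> \<parallel>\<omega>\<^sub>A\<parallel>\<^sup>2\<close> (\<open>smallest_sv_coercive\<close>), and the cross term between the two
  blocks, a small factor times the \<open>\<ell>\<^sup>1\<close> norm of \<open>\<omega>\<^sub>I\<close>, by the linear gain on the inactive block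
  (\<open>local_minimizer_if_excess_bounds\<close>).
\<close>

section \<open>Expansion of the objective\<close>

definition penalty_excess :: "(real \<Rightarrow> real) \<Rightarrow> real \<Rightarrow> real \<Rightarrow> real \<Rightarrow> real" where
  "penalty_excess \<rho> g t s = \<rho> (t + s) - \<rho> t - g * s"

lemma objective_add:
  fixes \<Psi> :: "real^'p^'n"
  shows "objective \<Psi> y \<rho> (x + w) - objective \<Psi> y \<rho> x =
    (norm (\<Psi> *v w))\<^sup>2 / 2
      + (\<Sum>i\<in>UNIV. penalty_excess \<rho> (dual_vector \<Psi> y x $ i) (x $ i) (w $ i))"
proof -
  have dual: "(\<Sum>i\<in>UNIV. dual_vector \<Psi> y x $ i * w $ i) = (y - \<Psi> *v x) \<bullet> (\<Psi> *v w)"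
    by (simp add: dual_vector_def flip: dot_lmul_matrix) (simp add: inner_vec_def)
  have "\<Psi> *v (x + w) - y = \<Psi> *v w - (y - \<Psi> *v x)"
    by (simp add: matrix_vector_right_distrib)
  moreover have "norm (\<Psi> *v x - y) = norm (y - \<Psi> *v x)"
    by (rule norm_minus_commute)
  ultimately have "(norm (\<Psi> *v (x + w) - y))\<^sup>2 =
      (norm (\<Psi> *v w))\<^sup>2 - 2 * ((y - \<Psi> *v x) \<bullet> (\<Psi> *v w)) + (norm (\<Psi> *v x - y))\<^sup>2"
    by (simp only: power2_norm_eq_inner inner_diff_left[of "\<Psi> *v w"] inner_diff_right[of _ "\<Psi> *v w"])
      (simp add: inner_commute)
  then show ?thesis
    by (simp only: objective_def penalty_excess_def sum_subtractf dual) (simp add: field_simps)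
qed

text \<open>The unit column is what gives the quadratic term its coefficient \<open>1 / 2\<close>. The inequality
  holds for every step \<open>s\<close>, not only for small ones; the bridge penalty needs this.\<close>

lemma coordinatewise_minimizer_excess:
  fixes \<Psi> :: "real^'p^'n"
  assumes unit: "norm (column i \<Psi>) = 1"
    and min: "coordinatewise_minimizer (objective \<Psi> y \<rho>) x"
  shows "0 \<le> s\<^sup>2 / 2 + penalty_excess \<rho> (dual_vector \<Psi> y x $ i) (x $ i) s"
proof -
  have upd: "(\<chi> j. if j = i then t else x $ j) = x + axis i (t - x $ i)" for t
    by (simp add: vec_eq_iff axis_def)
  have "objective \<Psi> y \<rho> x \<le> objective \<Psi> y \<rho> (x + axis i s)"
    using min[unfolded coordinatewise_minimizer_def, rule_format, of i]
    by (simp add: is_arg_min_def upd not_less) (metis add_diff_cancel_left' axis_eq_0_iff add.right_neutral diff_self)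
  moreover have "norm (\<Psi> *v axis i s) = \<bar>s\<bar>"
  proof -
    have "\<Psi> *v axis i s = s *\<^sub>R column i \<Psi>"
      by (simp add: matrix_vector_mult_def axis_def column_def vec_eq_iff if_distrib cong: if_cong)
    then show ?thesis by (simp add: unit)
  qed
  moreover have "(\<Sum>j\<in>UNIV. penalty_excess \<rho> (dual_vector \<Psi> y x $ j) (x $ j) (axis i s $ j))
      = penalty_excess \<rho> (dual_vector \<Psi> y x $ i) (x $ i) s"
    by (subst sum.remove[of _ i]) (auto simp: axis_def penalty_excess_def intro!: sum.neutral)
  ultimately show ?thesis
    using objective_add[of \<Psi> y \<rho> x "axis i s"] by simp
qed

section \<open>From coordinate bounds to local minimality\<close>

lemma local_minimizer_iff_eventually:
  "local_minimizer J x \<longleftrightarrow> (\<forall>\<^sub>F w in nhds 0. J x \<le> J (x + w))"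
  by (simp add: local_minimizer_def eventually_nhds_metric)

lemma eventually_nhds_0_components:
  fixes P :: "'p::finite \<Rightarrow> real \<Rightarrow> bool"
  assumes "\<And>i. \<forall>\<^sub>F s in nhds 0. P i s"
  shows "\<forall>\<^sub>F w in nhds (0 :: real^'p). \<forall>i. P i (w $ i)"
proof (rule eventually_all_finite)
  fix i
  have "((\<lambda>w :: real^'p. w $ i) \<longlongrightarrow> 0 $ i) (nhds 0)"
    by (intro tendsto_vec_nth filterlim_ident)
  then show "\<forall>\<^sub>F w in nhds (0 :: real^'p). P i (w $ i)"
    using assms[of i] by (simp add: filterlim_iff)
qed

lemma local_minimizer_if_excess_nonneg:
  fixes \<Psi> :: "real^'p^'n"
  assumes "\<And>i. \<forall>\<^sub>F s in nhds 0. 0 \<le> penalty_excess \<rho> (dual_vector \<Psi> y x $ i) (x $ i) s"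
  shows "local_minimizer (objective \<Psi> y \<rho>) x"
proof -
  have "\<forall>\<^sub>F w in nhds (0 :: real^'p).
      \<forall>i. 0 \<le> penalty_excess \<rho> (dual_vector \<Psi> y x $ i) (x $ i) (w $ i)"
    by (rule eventually_nhds_0_components) (rule assms)
  then show ?thesis
    unfolding local_minimizer_iff_eventually
  proof eventually_elim
    case (elim w)
    then have "0 \<le> (\<Sum>i\<in>UNIV. penalty_excess \<rho> (dual_vector \<Psi> y x $ i) (x $ i) (w $ i))"
      by (intro sum_nonneg) auto
    then show ?case
      using objective_add[of \<Psi> y \<rho> x w] zero_le_power2[of "norm (\<Psi> *v w)"] by linarith
  qed
qed

text \<open>Write \<open>u\<close> and \<open>v\<close> for the images of the active and the inactive part of \<open>\<omega>\<close>. In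
  \<open>\<parallel>u + v\<parallel>\<^sup>2 / 2 = \<parallel>u\<parallel>\<^sup>2 / 2 + u \<bullet> v + \<parallel>v\<parallel>\<^sup>2 / 2\<close> the first term pays for the quadratic loss on
  the active coordinates. The second is at least \<open>- \<parallel>u\<parallel> \<Sum>\<^sub>i \<bar>\<omega>\<^sub>i\<bar>\<close>, and \<open>\<parallel>u\<parallel>\<close> drops below the
  slopes \<open>c\<^sub>i\<close> of the inactive excesses as \<open>\<omega>\<close> tends to \<open>0\<close>.\<close>

lemma local_minimizer_if_excess_bounds:
  fixes \<Psi> :: "real^'p^'n" and \<kappa> :: real
  assumes unit: "\<And>i. norm (column i \<Psi>) = 1"
    and coercive: "\<And>w. (\<And>i. i \<notin> A \<Longrightarrow> w $ i = 0) \<Longrightarrow> \<kappa> * (norm w)\<^sup>2 \<le> (norm (\<Psi> *v w))\<^sup>2"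
    and active: "\<And>i. i \<in> A \<Longrightarrow>
      \<forall>\<^sub>F s in nhds 0. - (\<kappa> / 2 * s\<^sup>2) \<le> penalty_excess \<rho> (dual_vector \<Psi> y x $ i) (x $ i) s"
    and inactive: "\<And>i. i \<notin> A \<Longrightarrow>
      \<exists>c>0. \<forall>\<^sub>F s in nhds 0. c * \<bar>s\<bar> \<le> penalty_excess \<rho> (dual_vector \<Psi> y x $ i) (x $ i) s"
  shows "local_minimizer (objective \<Psi> y \<rho>) x"
proof -
  let ?e = "\<lambda>i. penalty_excess \<rho> (dual_vector \<Psi> y x $ i) (x $ i)"
  obtain c where c: "\<And>i. i \<notin> A \<Longrightarrow> c i > 0"
    "\<And>i. i \<notin> A \<Longrightarrow> \<forall>\<^sub>F s in nhds 0. c i * \<bar>s\<bar> \<le> ?e i s"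
    using inactive by metis
  define on where "on B w = (\<chi> i. if i \<in> B then w $ i else 0)" for B and w :: "real^'p"
  have components: "\<forall>\<^sub>F w in nhds (0 :: real^'p). \<forall>i.
      (i \<in> A \<longrightarrow> - (\<kappa> / 2 * (w $ i)\<^sup>2) \<le> ?e i (w $ i)) \<and> (i \<notin> A \<longrightarrow> c i * \<bar>w $ i\<bar> \<le> ?e i (w $ i))"
  proof (rule eventually_nhds_0_components)
    fix i
    show "\<forall>\<^sub>F s in nhds 0. (i \<in> A \<longrightarrow> - (\<kappa> / 2 * s\<^sup>2) \<le> ?e i s) \<and> (i \<notin> A \<longrightarrow> c i * \<bar>s\<bar> \<le> ?e i s)"
      by (cases "i \<in> A") (use active c in auto)
  qed
  have small: "\<forall>\<^sub>F w in nhds (0 :: real^'p). \<forall>i. i \<notin> A \<longrightarrow> norm (\<Psi> *v on A w) < c i"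
  proof (rule eventually_all_finite)
    fix i
    have "linear (on A)"
      by (auto intro!: linearI simp: on_def vec_eq_iff)
    then have "linear (\<lambda>w. \<Psi> *v on A w)"
      using linear_compose[OF _ matrix_vector_mul_linear[of \<Psi>], of "on A"] by (simp add: o_def)
    then have "isCont (\<lambda>w. norm (\<Psi> *v on A w)) 0"
      by (intro continuous_intros linear_continuous_at) (simp add: linear_conv_bounded_linear)
    then have lim: "((\<lambda>w. norm (\<Psi> *v on A w)) \<longlongrightarrow> norm (\<Psi> *v on A 0)) (nhds 0)"
      unfolding continuous_at tendsto_nhds_iff by blast
    have "on A 0 = 0" by (simp add: on_def vec_eq_iff)
    with lim have "((\<lambda>w. norm (\<Psi> *v on A w)) \<longlongrightarrow> 0) (nhds 0)" by simp
    then show "\<forall>\<^sub>F w in nhds (0 :: real^'p). i \<notin> A \<longrightarrow> norm (\<Psi> *v on A w) < c i"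
      using order_tendstoD(2)[of "\<lambda>w. norm (\<Psi> *v on A w)" 0 "nhds 0" "c i"] c(1)[of i]
      by (cases "i \<in> A") simp_all
  qed
  show ?thesis
    unfolding local_minimizer_iff_eventually
    using components small
  proof eventually_elim
    case (elim w)
    let ?u = "\<Psi> *v on A w" and ?v = "\<Psi> *v on (- A) w"
    have "w = on A w + on (- A) w" by (simp add: on_def vec_eq_iff)
    then have split: "\<Psi> *v w = ?u + ?v" by (metis matrix_vector_right_distrib)
    have v: "?v = (\<Sum>i\<in>-A. (w $ i) *\<^sub>R column i \<Psi>)"
      unfolding matrix_mult_sum
      by (rule sum.mono_neutral_cong_right) (auto simp: on_def scalar_mult_eq_scaleR)
    have "- (?u \<bullet> ?v) = (\<Sum>i\<in>-A. - ((w $ i) * (?u \<bullet> column i \<Psi>)))"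
      unfolding v by (simp add: inner_sum_right sum_negf)
    also have "\<dots> \<le> (\<Sum>i\<in>-A. ?e i (w $ i))"
    proof (rule sum_mono)
      fix i assume i: "i \<in> - A"
      have "\<bar>?u \<bullet> column i \<Psi>\<bar> \<le> c i"
        using Cauchy_Schwarz_ineq2[of ?u "column i \<Psi>"] elim(2)[rule_format, of i] i
        by (simp add: unit)
      then have "\<bar>w $ i\<bar> * \<bar>?u \<bullet> column i \<Psi>\<bar> \<le> \<bar>w $ i\<bar> * c i"
        by (rule mult_left_mono) simp
      moreover have "- ((w $ i) * (?u \<bullet> column i \<Psi>)) \<le> \<bar>w $ i\<bar> * \<bar>?u \<bullet> column i \<Psi>\<bar>"
        by (metis abs_ge_minus_self abs_mult)
      moreover have "\<bar>w $ i\<bar> * c i \<le> ?e i (w $ i)"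
        using elim(1)[rule_format, of i] i by (simp add: mult.commute)
      ultimately show "- ((w $ i) * (?u \<bullet> column i \<Psi>)) \<le> ?e i (w $ i)"
        by linarith
    qed
    finally have cross: "0 \<le> ?u \<bullet> ?v + (\<Sum>i\<in>-A. ?e i (w $ i))" by simp
    have norm_on: "(norm (on A w))\<^sup>2 = (\<Sum>i\<in>A. (w $ i)\<^sup>2)"
      unfolding power2_norm_eq_inner inner_vec_def
      by (rule sum.mono_neutral_cong_right) (auto simp: on_def power2_eq_square)
    have "- (\<kappa> / 2 * (norm (on A w))\<^sup>2) = (\<Sum>i\<in>A. - (\<kappa> / 2 * (w $ i)\<^sup>2))"
      unfolding norm_on by (simp add: sum_negf sum_distrib_left)
    also have "\<dots> \<le> (\<Sum>i\<in>A. ?e i (w $ i))"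
      using elim(1) by (intro sum_mono) auto
    finally have "- (\<kappa> / 2 * (norm (on A w))\<^sup>2) \<le> (\<Sum>i\<in>A. ?e i (w $ i))" .
    moreover have "\<kappa> * (norm (on A w))\<^sup>2 \<le> (norm ?u)\<^sup>2"
      by (rule coercive) (simp add: on_def)
    ultimately have act: "0 \<le> (norm ?u)\<^sup>2 / 2 + (\<Sum>i\<in>A. ?e i (w $ i))"
      by (simp add: field_simps)
    have "(\<Sum>i\<in>UNIV. ?e i (w $ i)) = (\<Sum>i\<in>A. ?e i (w $ i)) + (\<Sum>i\<in>-A. ?e i (w $ i))"
      by (subst sum.union_disjoint[symmetric]) auto
    moreover have "(norm (\<Psi> *v w))\<^sup>2 = (norm ?u)\<^sup>2 + 2 * (?u \<bullet> ?v) + (norm ?v)\<^sup>2"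
      unfolding split by (simp add: power2_norm_eq_inner inner_add_left inner_add_right inner_commute)
    ultimately show ?case
      using objective_add[of \<Psi> y \<rho> x w] cross act zero_le_power2[of "norm ?v"]
      by argo
  qed
qed

section \<open>The smallest singular value of the Gram matrix\<close>

lemma inner_add_scaleR_self:
  fixes a b :: "'a::real_inner"
  shows "(a + t *\<^sub>R b) \<bullet> (a + t *\<^sub>R b) = (norm a)\<^sup>2 + 2 * t * (a \<bullet> b) + t\<^sup>2 * (norm b)\<^sup>2"
  unfolding power2_norm_eq_inner inner_add_left inner_add_right inner_commute[of b a]
  by (simp add: inner_commute power2_eq_square algebra_simps)

text \<open>The Rayleigh quotient \<open>\<parallel>\<Psi> v\<parallel>\<^sup>2 / \<parallel>v\<parallel>\<^sup>2\<close> attains its minimum \<open>\<mu>\<close> over vectors supported on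
  \<open>A\<close>, and a minimizer is an eigenvector of the Gram matrix \<open>G\<close> of \<open>\<Psi>\<^sub>A\<close>. Because \<open>G\<close> is symmetric,
  \<open>G\<^sup>t G v = \<mu>\<^sup>2 v\<close>, so \<open>\<mu>\<close> is a singular value of \<open>G\<close> and bounds the smallest one from above.\<close>

lemma smallest_sv_coercive:
  fixes \<Psi> :: "real^'p^'n" and w :: "real^'p"
  assumes \<kappa>: "ereal \<kappa> < smallest_sv \<Psi> A" and supp: "\<And>i. i \<notin> A \<Longrightarrow> w $ i = 0"
  shows "\<kappa> * (norm w)\<^sup>2 \<le> (norm (\<Psi> *v w))\<^sup>2"
proof (cases "w = 0")
  case False
  define S where "S = {v :: real^'p. \<forall>i. i \<notin> A \<longrightarrow> v $ i = 0}"
  have sub: "subspace S" by (auto simp: S_def subspace_def)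
  have "compact (S \<inter> sphere 0 1)"
    by (simp add: closed_subspace sub closed_Int_compact)
  moreover have "(1 / norm w) *\<^sub>R w \<in> S \<inter> sphere 0 1"
    using False supp by (auto simp: S_def)
  moreover have "continuous_on (S \<inter> sphere 0 1) (\<lambda>v. (norm (\<Psi> *v v))\<^sup>2)"
    by (intro continuous_intros)
  ultimately obtain v where v: "v \<in> S" "norm v = 1"
    and min: "\<And>u. u \<in> S \<Longrightarrow> norm u = 1 \<Longrightarrow> (norm (\<Psi> *v v))\<^sup>2 \<le> (norm (\<Psi> *v u))\<^sup>2"
    using continuous_attains_inf[of "S \<inter> sphere 0 1" "\<lambda>v. (norm (\<Psi> *v v))\<^sup>2"] by force
  define \<mu> where "\<mu> = (norm (\<Psi> *v v))\<^sup>2"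
  have rayleigh: "\<mu> * (norm u)\<^sup>2 \<le> (norm (\<Psi> *v u))\<^sup>2" if u: "u \<in> S" for u
  proof (cases "u = 0")
    case False
    have "\<mu> \<le> (norm (\<Psi> *v ((1 / norm u) *\<^sub>R u)))\<^sup>2"
      unfolding \<mu>_def using u False by (intro min) (auto simp: S_def)
    then show ?thesis using False
      by (simp add: matrix_vector_mult_scaleR power_divide field_simps)
  qed simp
  define B where "B u = (\<Psi> *v v) \<bullet> (\<Psi> *v u) - \<mu> * (v \<bullet> u)" for u
  \<comment> \<open>\<open>2 B u\<close> is the derivative at \<open>0\<close> of \<open>\<parallel>\<Psi> (v + t u)\<parallel>\<^sup>2 - \<mu> \<parallel>v + t u\<parallel>\<^sup>2\<close>, a function of \<open>t\<close> that
    is nonnegative and vanishes at \<open>0\<close>.\<close>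
  have stationary: "B u = 0" if u: "u \<in> S" for u
  proof -
    define q where "q = (norm (\<Psi> *v u))\<^sup>2 - \<mu> * (norm u)\<^sup>2"
    have nonneg: "0 \<le> 2 * t * B u + t\<^sup>2 * q" for t
    proof -
      have "v + t *\<^sub>R u \<in> S" using sub v(1) u by (simp add: subspace_add subspace_scale)
      from rayleigh[OF this] have "\<mu> * ((v + t *\<^sub>R u) \<bullet> (v + t *\<^sub>R u))
          \<le> (\<Psi> *v v + t *\<^sub>R (\<Psi> *v u)) \<bullet> (\<Psi> *v v + t *\<^sub>R (\<Psi> *v u))"
        by (simp add: power2_norm_eq_inner matrix_vector_right_distrib matrix_vector_mult_scaleR)
      moreover have "(v + t *\<^sub>R u) \<bullet> (v + t *\<^sub>R u) = 1 + 2 * t * (v \<bullet> u) + t\<^sup>2 * (norm u)\<^sup>2"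
        using inner_add_scaleR_self[of v t u] v(2) by simp
      moreover have "(\<Psi> *v v + t *\<^sub>R (\<Psi> *v u)) \<bullet> (\<Psi> *v v + t *\<^sub>R (\<Psi> *v u))
          = \<mu> + 2 * t * ((\<Psi> *v v) \<bullet> (\<Psi> *v u)) + t\<^sup>2 * (norm (\<Psi> *v u))\<^sup>2"
        unfolding inner_add_scaleR_self \<mu>_def by simp
      ultimately have "\<mu> * (1 + 2 * t * (v \<bullet> u) + t\<^sup>2 * (norm u)\<^sup>2)
          \<le> \<mu> + 2 * t * ((\<Psi> *v v) \<bullet> (\<Psi> *v u)) + t\<^sup>2 * (norm (\<Psi> *v u))\<^sup>2"
        by (simp only:)
      then show ?thesis
        by (simp add: B_def q_def algebra_simps)
    qed
    have "((\<lambda>t. 2 * t * B u + t\<^sup>2 * q) has_real_derivative 2 * B u) (at 0)"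
      by (auto intro!: derivative_eq_intros)
    then have "2 * B u = 0"
      by (rule DERIV_local_min[where d = 1]) (use nonneg in auto)
    then show ?thesis by simp
  qed
  let ?G = "gram UNIV (\<lambda>i j. \<Psi> $ i $ j)"
  have G: "?G j k = column j \<Psi> \<bullet> column k \<Psi>" for j k
    by (simp add: gram_def column_def inner_vec_def)
  have eig: "(\<Sum>k\<in>A. ?G j k * v $ k) = \<mu> * v $ j" if j: "j \<in> A" for j
  proof -
    have "(\<Sum>k\<in>A. ?G j k * v $ k) = column j \<Psi> \<bullet> (\<Sum>k\<in>A. (v $ k) *\<^sub>R column k \<Psi>)"
      by (simp add: G inner_sum_right mult.commute)
    also have "(\<Sum>k\<in>A. (v $ k) *\<^sub>R column k \<Psi>) = \<Psi> *v v"
      unfolding matrix_mult_sum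
      by (rule sum.mono_neutral_cong_left) (use v(1) in \<open>auto simp: S_def scalar_mult_eq_scaleR\<close>)
    also have "column j \<Psi> \<bullet> (\<Psi> *v v) = \<mu> * v $ j"
    proof -
      have "axis j 1 \<in> S" using j by (auto simp: S_def axis_def)
      from stationary[OF this] show ?thesis
        by (simp add: B_def matrix_vector_mult_basis inner_axis inner_commute)
    qed
    finally show ?thesis .
  qed
  have "\<exists>i\<in>A. v $ i \<noteq> 0"
  proof (rule ccontr)
    assume "\<not> ?thesis"
    then have "v = 0" using v(1) by (auto simp: S_def vec_eq_iff)
    then show False using v(2) by simp
  qed
  moreover have "(\<Sum>k\<in>A. gram A ?G j k * v $ k) = \<mu>\<^sup>2 * v $ j" if j: "j \<in> A" for j
  proof -
    have "(\<Sum>k\<in>A. gram A ?G j k * v $ k) = (\<Sum>k\<in>A. \<Sum>i\<in>A. ?G i j * (?G i k * v $ k))"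
      by (simp add: gram_def[of A] sum_distrib_right mult.assoc)
    also have "\<dots> = (\<Sum>i\<in>A. ?G i j * (\<Sum>k\<in>A. ?G i k * v $ k))"
      by (subst sum.swap) (simp add: sum_distrib_left)
    also have "\<dots> = (\<Sum>i\<in>A. \<mu> * (?G j i * v $ i))"
    proof (rule sum.cong)
      fix i assume "i \<in> A"
      then show "?G i j * (\<Sum>k\<in>A. ?G i k * v $ k) = \<mu> * (?G j i * v $ i)"
        unfolding eig[OF \<open>i \<in> A\<close>] by (simp add: G inner_commute)
    qed simp
    also have "\<dots> = \<mu>\<^sup>2 * v $ j"
      using eig[OF j] by (simp flip: sum_distrib_left add: power2_eq_square mult.assoc)
    finally show ?thesis .
  qed
  ultimately have "\<mu> \<in> singular_values_on A ?G"
    by (auto simp: singular_values_on_def eigenvalue_on_def \<mu>_def intro!: exI[of _ "\<lambda>i. v $ i"])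
  then have "smallest_sv \<Psi> A \<le> ereal \<mu>"
    unfolding smallest_sv_def by (rule INF_lower)
  with \<kappa> have "\<kappa> \<le> \<mu>" by (metis ereal_less_eq(3) less_imp_le order_less_le_trans)
  then have "\<kappa> * (norm w)\<^sup>2 \<le> \<mu> * (norm w)\<^sup>2" by (intro mult_right_mono) auto
  also have "\<dots> \<le> (norm (\<Psi> *v w))\<^sup>2" by (rule rayleigh) (use supp in \<open>auto simp: S_def\<close>)
  finally show ?thesis .
qed simp

section \<open>Weakly convex penalties\<close>

text \<open>Let \<open>F(s)\<close> be the excess plus \<open>\<kappa> s\<^sup>2 / 2\<close>. Subtracting linear terms from a convex function
  leaves \<open>F\<close> convex, so \<open>F(\<theta> s) \<le> \<theta> F(s)\<close>; minimality gives \<open>F(\<theta> s) \<ge> - (1 - \<kappa>) \<theta>\<^sup>2 s\<^sup>2 / 2\<close>.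
  Dividing by \<open>\<theta>\<close> and letting it tend to \<open>0\<close> yields \<open>F(s) \<ge> 0\<close>, without differentiating \<open>\<rho>\<close>.\<close>

lemma excess_lower_bound_if_weakly_convex:
  fixes \<rho> :: "real \<Rightarrow> real"
  assumes min: "\<And>s. 0 \<le> s\<^sup>2 / 2 + penalty_excess \<rho> g t s"
    and conv: "\<epsilon> > 0" "convex_on (ball t \<epsilon>) (\<lambda>u. \<rho> u + \<kappa> / 2 * u\<^sup>2)"
  shows "\<forall>\<^sub>F s in nhds 0. - (\<kappa> / 2 * s\<^sup>2) \<le> penalty_excess \<rho> g t s"
proof -
  define F where "F s = penalty_excess \<rho> g t s + \<kappa> / 2 * s\<^sup>2" for s
  have nonneg: "0 \<le> F s" if s: "\<bar>s\<bar> < \<epsilon>" for s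
  proof -
    have "- ((1 - \<kappa>) / 2 * \<theta> * s\<^sup>2) \<le> F s" if \<theta>: "0 < \<theta>" "\<theta> < 1" for \<theta>
    proof -
      have "t \<in> ball t \<epsilon>" "t + s \<in> ball t \<epsilon>" using s conv(1) by (auto simp: dist_real_def)
      from convex_onD[OF conv(2) _ _ this, of \<theta>] \<theta>
      have "\<rho> (t + \<theta> * s) + \<kappa> / 2 * (t + \<theta> * s)\<^sup>2
          \<le> (1 - \<theta>) * (\<rho> t + \<kappa> / 2 * t\<^sup>2) + \<theta> * (\<rho> (t + s) + \<kappa> / 2 * (t + s)\<^sup>2)"
        by (simp add: algebra_simps)
      then have "F (\<theta> * s) \<le> \<theta> * F s"
        unfolding F_def penalty_excess_def
        by (simp add: power2_eq_square algebra_simps add_divide_distrib diff_divide_distrib)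
      moreover have "- ((1 - \<kappa>) / 2 * (\<theta> * s)\<^sup>2) \<le> F (\<theta> * s)"
        using min[of "\<theta> * s"] unfolding F_def by (simp add: algebra_simps diff_divide_distrib)
      ultimately have "\<theta> * (- ((1 - \<kappa>) / 2 * \<theta> * s\<^sup>2)) \<le> \<theta> * F s"
        by (simp add: power2_eq_square mult_ac)
      then show ?thesis using \<theta> by (simp only: mult_le_cancel_left_pos)
    qed
    then have "\<forall>\<^sub>F \<theta> in at_right (0::real). - ((1 - \<kappa>) / 2 * \<theta> * s\<^sup>2) \<le> F s"
      by (auto simp: eventually_at_right_field intro!: exI[of _ 1])
    moreover have "((\<lambda>\<theta>. - ((1 - \<kappa>) / 2 * \<theta> * s\<^sup>2)) \<longlongrightarrow> - ((1 - \<kappa>) / 2 * 0 * s\<^sup>2)) (at_right 0)"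
      by (intro tendsto_intros)
    ultimately show ?thesis
      using tendsto_upperbound[of _ _ "at_right (0::real)" "F s"] by force
  qed
  then show ?thesis
    unfolding eventually_nhds_metric F_def using conv(1)
    by (intro exI[of _ \<epsilon>]) (smt (verit) dist_real_def)
qed

lemma convex_on_if_supporting_lines:
  fixes f :: "real \<Rightarrow> real"
  assumes "convex S" and supp: "\<And>x. x \<in> S \<Longrightarrow> \<exists>m. \<forall>y\<in>S. f x + m * (y - x) \<le> f y"
  shows "convex_on S f"
proof (rule convex_onI)
  fix t x y :: real
  assume t: "0 < t" "t < 1" and xy: "x \<in> S" "y \<in> S"
  let ?z = "(1 - t) *\<^sub>R x + t *\<^sub>R y"
  have "?z \<in> S" using convexD_alt[OF assms(1) xy] t by simp
  then obtain m where m: "\<forall>y\<in>S. f ?z + m * (y - ?z) \<le> f y" using supp by blast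
  have "(1 - t) * (f ?z + m * (x - ?z)) + t * (f ?z + m * (y - ?z)) \<le> (1 - t) * f x + t * f y"
    using m xy t by (intro add_mono mult_left_mono) auto
  then show "f ?z \<le> (1 - t) * f x + t * f y" by (simp add: algebra_simps)
qed fact

section \<open>Convexity of the shifted SCAD and MCP penalties\<close>

text \<open>The projection of \<open>t\<close> onto \<open>[- a, a]\<close>. It gives expressions without case distinctions for
  the two convex functions from which the penalties are built, and for their subgradients.\<close>

definition clamp_abs :: "real \<Rightarrow> real \<Rightarrow> real" where
  "clamp_abs a t = max (- a) (min a t)"

text \<open>This is the Huber function: \<open>t\<^sup>2\<close> on \<open>[- a, a]\<close> and \<open>2 a \<bar>t\<bar> - a\<^sup>2\<close> outside. It is the
  largest of the affine functions \<open>2 c t - c\<^sup>2\<close> with \<open>\<bar>c\<bar> \<le> a\<close>, attained at the projection of \<open>t\<close>.\<close>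

lemma convex_on_huber:
  assumes "a \<ge> 0"
  shows "convex_on UNIV (\<lambda>t. 2 * clamp_abs a t * t - (clamp_abs a t)\<^sup>2)"
proof (rule convex_on_if_supporting_lines)
  fix x :: real
  have "2 * clamp_abs a x * x - (clamp_abs a x)\<^sup>2 + 2 * clamp_abs a x * (y - x)
      \<le> 2 * clamp_abs a y * y - (clamp_abs a y)\<^sup>2" for y
  proof -
    have "(y - clamp_abs a y)\<^sup>2 \<le> (y - clamp_abs a x)\<^sup>2"
      unfolding abs_le_square_iff[symmetric] using assms by (auto simp: clamp_abs_def)
    then show ?thesis by (simp add: power2_eq_square algebra_simps)
  qed
  then show "\<exists>m. \<forall>y\<in>UNIV. 2 * clamp_abs a x * x - (clamp_abs a x)\<^sup>2 + m * (y - x)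
      \<le> 2 * clamp_abs a y * y - (clamp_abs a y)\<^sup>2"
    by blast
qed simp

text \<open>The supporting line at \<open>x\<close> has slope twice the residual of the projection; the variational
  inequality of the projection bounds its slack below by a square.\<close>

lemma convex_on_squared_distance_interval:
  assumes "a \<ge> 0"
  shows "convex_on UNIV (\<lambda>t. (t - clamp_abs a t)\<^sup>2)"
proof (rule convex_on_if_supporting_lines)
  fix x :: real
  have "(x - clamp_abs a x)\<^sup>2 + 2 * (x - clamp_abs a x) * (y - x) \<le> (y - clamp_abs a y)\<^sup>2" for y
  proof -
    let ?r = "x - clamp_abs a x" and ?s = "y - clamp_abs a y"
    \<comment> \<open>The residual at \<open>x\<close> is normal to the interval at the projection of \<open>x\<close>.\<close>
    have "0 \<le> ?r * (clamp_abs a x - clamp_abs a y)"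
      using assms by (auto simp: clamp_abs_def max_def min_def zero_le_mult_iff)
    moreover have "0 \<le> (?r - ?s)\<^sup>2" by simp
    ultimately show ?thesis by (simp add: power2_eq_square algebra_simps)
  qed
  then show "\<exists>m. \<forall>y\<in>UNIV. (x - clamp_abs a x)\<^sup>2 + m * (y - x) \<le> (y - clamp_abs a y)\<^sup>2"
    by blast
qed simp

lemma convex_on_eq_on:
  assumes "convex_on S f" and "\<And>u. u \<in> S \<Longrightarrow> g u = f u"
  shows "convex_on S g"
proof -
  have "a *\<^sub>R u + b *\<^sub>R v \<in> S"
    if "u \<in> S" "v \<in> S" "0 \<le> a" "0 \<le> b" "a + b = 1" for a b u v
    using convexD[OF convex_on_imp_convex[OF assms(1)]] that by blast
  with assms show ?thesis by (simp add: convex_on_def)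
qed

lemma convex_on_mult_abs: "c \<ge> 0 \<Longrightarrow> convex S \<Longrightarrow> convex_on S (\<lambda>t::real. c * \<bar>t\<bar>)"
  using convex_on_cmul[OF _ convex_on_dist[of S 0]] by (simp add: dist_real_def)

text \<open>Adding \<open>t\<^sup>2 / (2 \<tau>)\<close> removes the concave part of MCP and leaves \<open>\<lambda> \<bar>t\<bar>\<close> plus \<open>1 / (2 \<tau>)\<close> times
  the squared distance of \<open>t\<close> to \<open>[- \<tau> \<lambda>, \<tau> \<lambda>]\<close>.\<close>

lemma convex_on_mcp:
  assumes "lam > 0" "\<tau> > 0"
  shows "convex_on UNIV (\<lambda>t. pen_mcp lam \<tau> t + (1 / \<tau>) / 2 * t\<^sup>2)"
proof -
  have "pen_mcp lam \<tau> t + (1 / \<tau>) / 2 * t\<^sup>2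
      = lam * \<bar>t\<bar> + (1 / \<tau>) / 2 * (t - clamp_abs (\<tau> * lam) t)\<^sup>2" for t
  proof -
    consider "\<bar>t\<bar> < \<tau> * lam" | "t \<ge> \<tau> * lam" | "t \<le> - (\<tau> * lam)" by linarith
    then show ?thesis
    proof cases
      case 1
      then have "clamp_abs (\<tau> * lam) t = t" unfolding clamp_abs_def by linarith
      with 1 show ?thesis using assms by (simp add: pen_mcp_def field_simps)
    next
      case 2
      then have "clamp_abs (\<tau> * lam) t = \<tau> * lam" "\<bar>t\<bar> = t"
        using assms mult_pos_pos[of \<tau> lam] unfolding clamp_abs_def by linarith+
      with 2 show ?thesis using assms by (simp add: pen_mcp_def field_simps power2_eq_square)
    next
      case 3
      then have "clamp_abs (\<tau> * lam) t = - (\<tau> * lam)" "\<bar>t\<bar> = - t"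
        using assms mult_pos_pos[of \<tau> lam] unfolding clamp_abs_def by linarith+
      with 3 show ?thesis using assms by (simp add: pen_mcp_def field_simps power2_eq_square)
    qed
  qed
  moreover have "convex_on UNIV (\<lambda>t. lam * \<bar>t\<bar> + (1 / \<tau>) / 2 * (t - clamp_abs (\<tau> * lam) t)\<^sup>2)"
    using assms by (intro convex_on_add convex_on_mult_abs convex_on_cmul
        convex_on_squared_distance_interval) auto
  ultimately show ?thesis by simp
qed

text \<open>After the shift, SCAD is \<open>\<lambda> \<bar>t\<bar>\<close> plus \<open>1 / (2 (\<tau> - 1))\<close> times the sum of the Huber function
  with threshold \<open>\<lambda>\<close> and the squared distance of \<open>t\<close> to \<open>[- \<lambda> \<tau>, \<lambda> \<tau>]\<close>.\<close>

lemma convex_on_scad: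
  assumes "lam > 0" "\<tau> > 1"
  shows "convex_on UNIV (\<lambda>t. pen_scad lam \<tau> t + (1 / (\<tau> - 1)) / 2 * t\<^sup>2)"
proof -
  let ?h = "\<lambda>t. 2 * clamp_abs lam t * t - (clamp_abs lam t)\<^sup>2"
  have le: "lam < lam * \<tau>" using assms by simp
  define q where "q = \<tau> - 1"
  have \<tau>: "\<tau> = 1 + q" "q > 0" using assms by (auto simp: q_def)
  have "pen_scad lam \<tau> t + (1 / (\<tau> - 1)) / 2 * t\<^sup>2
      = lam * \<bar>t\<bar> + (1 / (\<tau> - 1)) / 2 * (?h t + (t - clamp_abs (lam * \<tau>) t)\<^sup>2)" for t
  proof -
    consider "\<bar>t\<bar> \<le> lam" | "lam < t" "t \<le> lam * \<tau>" | "t > lam * \<tau>"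
      | "t < - lam" "- (lam * \<tau>) \<le> t" | "t < - (lam * \<tau>)" by linarith
    then show ?thesis
    proof cases
      case 1
      then have "clamp_abs lam t = t" "clamp_abs (lam * \<tau>) t = t" using le unfolding clamp_abs_def by linarith+
      moreover have "\<not> \<bar>t\<bar> > lam * \<tau>" "\<not> \<bar>t\<bar> > lam" using 1 le by linarith+
      ultimately show ?thesis by (simp add: pen_scad_def power2_eq_square)
    next
      case 2
      then have "clamp_abs lam t = lam" "clamp_abs (lam * \<tau>) t = t" "\<bar>t\<bar> = t" using le assms(1)
        unfolding clamp_abs_def by linarith+
      with 2 show ?thesis using assms(1) le \<tau>(2) unfolding \<tau>(1)
        by (simp add: pen_scad_def power2_eq_square field_simps)
    next
      case 3
      then have "clamp_abs lam t = lam" "clamp_abs (lam * \<tau>) t = lam * \<tau>" "\<bar>t\<bar> = t" using le assms(1)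
        unfolding clamp_abs_def by linarith+
      with 3 show ?thesis using assms(1) le \<tau>(2) unfolding \<tau>(1)
        by (simp add: pen_scad_def power2_eq_square field_simps)
    next
      case 4
      then have "clamp_abs lam t = - lam" "clamp_abs (lam * \<tau>) t = t" "\<bar>t\<bar> = - t" using le assms(1)
        unfolding clamp_abs_def by linarith+
      with 4 show ?thesis using assms(1) le \<tau>(2) unfolding \<tau>(1)
        by (simp add: pen_scad_def power2_eq_square field_simps)
    next
      case 5
      then have clamp: "clamp_abs lam t = - lam" "clamp_abs (lam * \<tau>) t = - (lam * \<tau>)" "\<bar>t\<bar> = - t"
        using le assms(1) unfolding clamp_abs_def by linarith+
      have big: "\<bar>t\<bar> > lam * \<tau>" using 5 by linarith
      show ?thesis
        unfolding pen_scad_def if_P[OF big] unfolding clamp unfolding \<tau>(1)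
        using \<tau>(2) by (simp add: power2_eq_square field_simps)
    qed
  qed
  moreover have "convex_on UNIV
      (\<lambda>t. lam * \<bar>t\<bar> + (1 / (\<tau> - 1)) / 2 * (?h t + (t - clamp_abs (lam * \<tau>) t)\<^sup>2))"
    using assms by (intro convex_on_add convex_on_mult_abs convex_on_cmul
        convex_on_squared_distance_interval convex_on_huber) auto
  ultimately show ?thesis by simp
qed

section \<open>The bridge penalty at an active coordinate\<close>

text \<open>Along the ray \<open>r \<mapsto> r t\<close>, stationarity at \<open>r = 1\<close> determines \<open>g t = \<tau> \<lambda> \<bar>t\<bar>\<^sup>\<tau>\<close>, and the
  comparison with \<open>r = 0\<close> then says \<open>(1 - \<tau>) \<lambda> \<bar>t\<bar>\<^sup>\<tau> \<le> t\<^sup>2 / 2\<close>. The left-hand side of the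
  conclusion is \<open>- \<rho>''(t)\<close>.\<close>

lemma bridge_second_derivative_bound:
  assumes \<tau>: "0 < \<tau>" "\<tau> < 1" and lam: "lam > 0" and t: "t \<noteq> 0"
    and min: "\<And>s. 0 \<le> s\<^sup>2 / 2 + penalty_excess (pen_bridge lam \<tau>) g t s"
  shows "lam * \<tau> * (1 - \<tau>) * \<bar>t\<bar> powr (\<tau> - 2) \<le> \<tau> / 2"
proof -
  define P where "P = lam * \<bar>t\<bar> powr \<tau>"
  define f where "f r = (r - 1)\<^sup>2 * t\<^sup>2 / 2 + P * (r powr \<tau> - 1) - g * t * (r - 1)" for r
  have f: "0 \<le> f r" if "r \<ge> 0" for r
    using min[of "(r - 1) * t"] that
    by (simp add: f_def P_def penalty_excess_def pen_bridge_def algebra_simps powr_mult abs_mult power2_eq_square)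
  have "(f has_real_derivative P * \<tau> - g * t) (at 1)"
    unfolding f_def by (auto intro!: derivative_eq_intros)
  then have stationary: "P * \<tau> - g * t = 0"
    by (rule DERIV_local_min[where d = 1]) (use f in \<open>auto simp: f_def\<close>)
  have "0 \<le> t\<^sup>2 / 2 - P + g * t" using f[of 0] by (simp add: f_def)
  with stationary have P: "(1 - \<tau>) * P \<le> t\<^sup>2 / 2" by (simp add: algebra_simps)
  have "\<bar>t\<bar> powr (\<tau> - 2) = \<bar>t\<bar> powr \<tau> / t\<^sup>2"
    using t by (simp add: powr_diff)
  then have "lam * \<tau> * (1 - \<tau>) * \<bar>t\<bar> powr (\<tau> - 2) = \<tau> / t\<^sup>2 * ((1 - \<tau>) * P)"
    by (simp add: P_def)
  also have "\<dots> \<le> \<tau> / t\<^sup>2 * (t\<^sup>2 / 2)"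
    using P \<tau>(1) by (intro mult_left_mono) auto
  also have "\<dots> = \<tau> / 2" using t by simp
  finally show ?thesis .
qed

lemma convex_on_bridge:
  assumes \<tau>: "0 < \<tau>" "\<tau> < 1" and lam: "lam > 0" and a: "a > 0"
    and bound: "lam * \<tau> * (1 - \<tau>) * a powr (\<tau> - 2) \<le> \<kappa>"
  shows "convex_on {a..} (\<lambda>t. lam * t powr \<tau> + \<kappa> / 2 * t\<^sup>2)"
proof (rule f''_ge0_imp_convex)
  fix t assume t: "t \<in> {a..}"
  then have pos: "t > 0" using a by auto
  show "((\<lambda>t. lam * t powr \<tau> + \<kappa> / 2 * t\<^sup>2) has_real_derivative
      lam * \<tau> * t powr (\<tau> - 1) + \<kappa> * t) (at t)"
    using pos by (auto intro!: derivative_eq_intros)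
  show "((\<lambda>t. lam * \<tau> * t powr (\<tau> - 1) + \<kappa> * t) has_real_derivative
      lam * \<tau> * (\<tau> - 1) * t powr (\<tau> - 2) + \<kappa>) (at t)"
    using pos by (auto intro!: derivative_eq_intros)
  have "lam * \<tau> * (1 - \<tau>) * t powr (\<tau> - 2) \<le> lam * \<tau> * (1 - \<tau>) * a powr (\<tau> - 2)"
    using t a \<tau> lam by (intro mult_left_mono powr_mono2') auto
  with bound show "0 \<le> lam * \<tau> * (\<tau> - 1) * t powr (\<tau> - 2) + \<kappa>"
    by (simp add: algebra_simps)
qed simp

lemma convex_on_reflect:
  fixes f :: "real \<Rightarrow> real"
  assumes "convex_on S f"
  shows "convex_on (uminus ` S) (\<lambda>t. f (- t))"
proof (rule convex_onI)
  show "convex (uminus ` S)" using assms convex_negations convex_on_imp_convex by blast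
  fix t x y :: real assume "0 < t" "t < 1" "x \<in> uminus ` S" "y \<in> uminus ` S"
  then show "f (- ((1 - t) *\<^sub>R x + t *\<^sub>R y)) \<le> (1 - t) * f (- x) + t * f (- y)"
    using convex_onD[OF assms, of t "- x" "- y"] by (auto simp: algebra_simps)
qed

text \<open>The bound on the second derivative at \<open>t\<close> is \<open>\<tau> / 2 < \<kappa>\<close>; by continuity \<open>\<kappa>\<close> still works at some
  \<open>a < \<bar>t\<bar>\<close>, and then on the whole half-line from \<open>a\<close>, because \<open>\<bar>\<rho>''\<bar>\<close> decreases there.\<close>

lemma bridge_weakly_convex_near_minimizer:
  assumes \<tau>: "0 < \<tau>" "\<tau> < 1" and lam: "lam > 0" and t: "t \<noteq> 0"
    and min: "\<And>s. 0 \<le> s\<^sup>2 / 2 + penalty_excess (pen_bridge lam \<tau>) g t s"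
    and \<kappa>: "\<tau> / 2 < \<kappa>"
  shows "\<exists>\<epsilon>>0. convex_on (ball t \<epsilon>) (\<lambda>u. pen_bridge lam \<tau> u + \<kappa> / 2 * u\<^sup>2)"
proof -
  have "((\<lambda>a. lam * \<tau> * (1 - \<tau>) * a powr (\<tau> - 2)) \<longlongrightarrow> lam * \<tau> * (1 - \<tau>) * \<bar>t\<bar> powr (\<tau> - 2))
      (at_left \<bar>t\<bar>)"
    using t by (intro tendsto_intros) auto
  then have "\<forall>\<^sub>F a in at_left \<bar>t\<bar>. lam * \<tau> * (1 - \<tau>) * a powr (\<tau> - 2) < \<kappa>"
    using bridge_second_derivative_bound[OF \<tau> lam t min] \<kappa> by (intro order_tendstoD) auto
  moreover have "\<forall>\<^sub>F a in at_left \<bar>t\<bar>. 0 < a \<and> a < \<bar>t\<bar>"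
    using t by (auto simp: eventually_at_left_field intro!: exI[of _ 0])
  ultimately have "\<forall>\<^sub>F a in at_left \<bar>t\<bar>.
      lam * \<tau> * (1 - \<tau>) * a powr (\<tau> - 2) < \<kappa> \<and> 0 < a \<and> a < \<bar>t\<bar>"
    by (rule eventually_conj)
  then obtain a where a: "0 < a" "a < \<bar>t\<bar>" "lam * \<tau> * (1 - \<tau>) * a powr (\<tau> - 2) \<le> \<kappa>"
    using eventually_happens[of _ "at_left \<bar>t\<bar>"] by (auto intro: less_imp_le)
  let ?h = "\<lambda>u. lam * u powr \<tau> + \<kappa> / 2 * u\<^sup>2"
  have right: "convex_on {a..} ?h" by (rule convex_on_bridge) (use \<tau> lam a in auto)
  have "convex_on (ball t (\<bar>t\<bar> - a)) (\<lambda>u. pen_bridge lam \<tau> u + \<kappa> / 2 * u\<^sup>2)"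
  proof (cases "t > 0")
    case True
    have "convex_on (ball t (\<bar>t\<bar> - a)) ?h"
      using True by (intro convex_on_subset[OF right]) (auto simp: dist_real_def)
    moreover have "pen_bridge lam \<tau> u + \<kappa> / 2 * u\<^sup>2 = ?h u" if "u \<in> ball t (\<bar>t\<bar> - a)" for u
      using that True a by (auto simp: pen_bridge_def dist_real_def)
    ultimately show ?thesis by (rule convex_on_eq_on)
  next
    case False
    have "convex_on (ball t (\<bar>t\<bar> - a)) (\<lambda>u. ?h (- u))"
      using False by (intro convex_on_subset[OF convex_on_reflect[OF right]]) (auto simp: dist_real_def)
    moreover have "pen_bridge lam \<tau> u + \<kappa> / 2 * u\<^sup>2 = ?h (- u)" if "u \<in> ball t (\<bar>t\<bar> - a)" for u
      using that False a by (auto simp: pen_bridge_def dist_real_def)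
    ultimately show ?thesis by (rule convex_on_eq_on)
  qed
  then show ?thesis using a(2) by (intro exI[of _ "\<bar>t\<bar> - a"]) auto
qed

section \<open>Excess bounds at inactive coordinates\<close>

text \<open>The jump of height \<open>\<lambda>\<close> at zero dominates every linear term.\<close>

lemma l0_excess_nonneg_at_zero:
  assumes "lam > 0"
  shows "\<forall>\<^sub>F s in nhds 0. 0 \<le> penalty_excess (pen_l0 lam) g 0 s"
proof -
  have "((\<lambda>s. g * s) \<longlongrightarrow> g * 0) (nhds 0)" by (intro tendsto_intros filterlim_ident)
  then have "\<forall>\<^sub>F s in nhds 0. g * s < lam" using assms by (intro order_tendstoD) auto
  then show ?thesis
    by eventually_elim (auto simp: penalty_excess_def pen_l0_def)
qed

text \<open>The slope of \<open>\<lambda> \<bar>s\<bar>\<^sup>\<tau>\<close> is infinite at zero, so any constant in place of the factor \<open>1\<close> would do;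
  it is written out to match the form of the bound on inactive coordinates.\<close>

lemma bridge_excess_at_zero:
  assumes \<tau>: "0 < \<tau>" "\<tau> < 1" and lam: "lam > 0"
  shows "\<forall>\<^sub>F s in nhds 0. 1 * \<bar>s\<bar> \<le> penalty_excess (pen_bridge lam \<tau>) g 0 s"
proof -
  have "((\<lambda>s::real. (1 + \<bar>g\<bar>) * \<bar>s\<bar> powr (1 - \<tau>)) \<longlongrightarrow> (1 + \<bar>g\<bar>) * \<bar>0\<bar> powr (1 - \<tau>)) (nhds 0)"
    using \<tau> by (intro tendsto_mult tendsto_const tendsto_powr' tendsto_rabs filterlim_ident) auto
  then have "\<forall>\<^sub>F s in nhds (0::real). (1 + \<bar>g\<bar>) * \<bar>s\<bar> powr (1 - \<tau>) < lam"
    using lam by (intro order_tendstoD) auto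
  then show ?thesis
  proof eventually_elim
    case (elim s)
    have "(1 + \<bar>g\<bar>) * \<bar>s\<bar> = (1 + \<bar>g\<bar>) * \<bar>s\<bar> powr (1 - \<tau>) * \<bar>s\<bar> powr \<tau>"
      by (simp add: powr_add[symmetric] mult.assoc)
    also have "\<dots> \<le> lam * \<bar>s\<bar> powr \<tau>" using elim by (intro mult_right_mono) auto
    finally have "\<bar>s\<bar> + \<bar>g\<bar> * \<bar>s\<bar> \<le> lam * \<bar>s\<bar> powr \<tau>" by (simp add: algebra_simps)
    moreover have "g * s \<le> \<bar>g\<bar> * \<bar>s\<bar>" by (metis abs_ge_self abs_mult)
    ultimately show ?case by (simp add: penalty_excess_def pen_bridge_def)
  qed
qed

lemma excess_at_zero_if_steep:
  fixes \<rho> :: "real \<Rightarrow> real"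
  assumes zero: "\<rho> 0 = 0" and g: "\<bar>g\<bar> < lam"
    and steep: "\<forall>\<^sub>F s in nhds 0. lam * \<bar>s\<bar> - K * s\<^sup>2 \<le> \<rho> s"
  shows "\<exists>c>0. \<forall>\<^sub>F s in nhds 0. c * \<bar>s\<bar> \<le> penalty_excess \<rho> g 0 s"
proof (intro exI conjI)
  \<comment> \<open>Half of the gap \<open>lam - \<bar>g\<bar>\<close> absorbs the quadratic term, the other half remains.\<close>
  let ?c = "(lam - \<bar>g\<bar>) / 2"
  show "?c > 0" using g by simp
  have "((\<lambda>s. K * \<bar>s\<bar>) \<longlongrightarrow> K * \<bar>0\<bar>) (nhds (0::real))" by (intro tendsto_intros filterlim_ident)
  then have "\<forall>\<^sub>F s in nhds (0::real). K * \<bar>s\<bar> < ?c" using g by (intro order_tendstoD) auto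
  then show "\<forall>\<^sub>F s in nhds 0. ?c * \<bar>s\<bar> \<le> penalty_excess \<rho> g 0 s"
    using steep
  proof eventually_elim
    case (elim s)
    have "K * s\<^sup>2 = K * \<bar>s\<bar> * \<bar>s\<bar>" by (simp add: power2_eq_square)
    also have "\<dots> \<le> ?c * \<bar>s\<bar>" using elim(1) by (intro mult_right_mono) auto
    finally have "K * s\<^sup>2 \<le> ?c * \<bar>s\<bar>" .
    moreover have "g * s \<le> \<bar>g\<bar> * \<bar>s\<bar>" by (metis abs_ge_self abs_mult)
    moreover have "?c * \<bar>s\<bar> + ?c * \<bar>s\<bar> = lam * \<bar>s\<bar> - \<bar>g\<bar> * \<bar>s\<bar>" by (simp add: field_simps)
    ultimately show ?case using elim(2) by (simp only: penalty_excess_def zero add_0)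
  qed
qed

lemma eventually_abs_less_nhds_0: "a > 0 \<Longrightarrow> \<forall>\<^sub>F s in nhds 0. \<bar>s::real\<bar> < a"
  by (auto simp: eventually_nhds_metric dist_real_def)

lemma scad_steep_at_zero:
  assumes "lam > 0" "\<tau> > 1"
  shows "\<forall>\<^sub>F s in nhds 0. lam * \<bar>s\<bar> - 0 * s\<^sup>2 \<le> pen_scad lam \<tau> s"
  using eventually_abs_less_nhds_0[OF assms(1)]
proof eventually_elim
  case (elim s)
  moreover have "lam < lam * \<tau>" using assms by simp
  ultimately have "\<not> \<bar>s\<bar> > lam * \<tau>" "\<not> \<bar>s\<bar> > lam" by linarith+
  then show ?case by (simp add: pen_scad_def)
qed

lemma mcp_steep_at_zero:
  assumes "lam > 0" "\<tau> > 0"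
  shows "\<forall>\<^sub>F s in nhds 0. lam * \<bar>s\<bar> - 1 / (2 * \<tau>) * s\<^sup>2 \<le> pen_mcp lam \<tau> s"
  using eventually_abs_less_nhds_0[OF mult_pos_pos[OF assms(2,1)]]
  by eventually_elim (use assms in \<open>simp add: pen_mcp_def field_simps\<close>)

section \<open>Penalties that are locally convex\<close>

text \<open>The term \<open>0 / 2 * u\<^sup>2\<close> marks the case \<open>\<kappa> = 0\<close> of weak convexity.\<close>

lemma l0_convex_near_active:
  assumes "t \<noteq> 0"
  shows "convex_on (ball t \<bar>t\<bar>) (\<lambda>u. pen_l0 lam u + 0 / 2 * u\<^sup>2)"
  by (rule convex_on_eq_on[where f = "\<lambda>_. lam"])
    (auto simp: convex_on_const pen_l0_def dist_real_def)

text \<open>Between the knots the penalty is \<open>\<lambda> \<bar>u\<bar>\<close>, including the kink at zero, so that inactive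
  coordinates are covered as well; beyond them it is constant.\<close>

lemma capped_convex_off_knots:
  assumes "lam > 0" "\<tau> > 0" and t: "\<bar>t\<bar> \<noteq> lam * \<tau>"
  shows "\<exists>\<epsilon>>0. convex_on (ball t \<epsilon>) (\<lambda>u. pen_capped lam \<tau> u + 0 / 2 * u\<^sup>2)"
proof (cases "\<bar>t\<bar> < lam * \<tau>")
  case True
  have "convex_on (ball t (lam * \<tau> - \<bar>t\<bar>)) (\<lambda>u. pen_capped lam \<tau> u + 0 / 2 * u\<^sup>2)"
  proof (rule convex_on_eq_on)
    show "convex_on (ball t (lam * \<tau> - \<bar>t\<bar>)) (\<lambda>u. lam * \<bar>u\<bar>)"
      using assms by (intro convex_on_mult_abs) auto
    fix u assume "u \<in> ball t (lam * \<tau> - \<bar>t\<bar>)"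
    then have "\<bar>u\<bar> < lam * \<tau>" unfolding mem_ball dist_real_def by linarith
    then show "pen_capped lam \<tau> u + 0 / 2 * u\<^sup>2 = lam * \<bar>u\<bar>" by (simp add: pen_capped_def)
  qed
  with True show ?thesis by (intro exI[of _ "lam * \<tau> - \<bar>t\<bar>"]) simp
next
  case False
  have "convex_on (ball t (\<bar>t\<bar> - lam * \<tau>)) (\<lambda>u. pen_capped lam \<tau> u + 0 / 2 * u\<^sup>2)"
  proof (rule convex_on_eq_on)
    show "convex_on (ball t (\<bar>t\<bar> - lam * \<tau>)) (\<lambda>u. lam\<^sup>2 * \<tau>)"
      by (simp add: convex_on_const)
    fix u assume "u \<in> ball t (\<bar>t\<bar> - lam * \<tau>)"
    then have "\<bar>u\<bar> > lam * \<tau>" unfolding mem_ball dist_real_def by linarith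
    then show "pen_capped lam \<tau> u + 0 / 2 * u\<^sup>2 = lam\<^sup>2 * \<tau>" by (simp add: pen_capped_def)
  qed
  with False t show ?thesis by (intro exI[of _ "\<bar>t\<bar> - lam * \<tau>"]) simp
qed

section \<open>Local minimality for the five penalties\<close>

text \<open>The common form of SCAD and MCP: weakly convex on the whole line, with slope at least \<open>lam\<close> at zero.\<close>

lemma local_minimizer_if_weakly_convex_steep:
  fixes \<Psi> :: "real^'p^'n" and \<kappa> :: real
  assumes unit: "\<And>i. norm (column i \<Psi>) = 1"
    and min: "coordinatewise_minimizer (objective \<Psi> y \<rho>) x"
    and sv: "ereal \<kappa> < smallest_sv \<Psi> A"
    and A: "A = active_set x"
    and conv: "convex_on UNIV (\<lambda>u. \<rho> u + \<kappa> / 2 * u\<^sup>2)"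
    and steep: "\<forall>\<^sub>F s in nhds 0. lam * \<bar>s\<bar> - K * s\<^sup>2 \<le> \<rho> s"
    and zero: "\<rho> 0 = 0"
    and dual: "infnorm_on (- A) (dual_vector \<Psi> y x) < lam"
  shows "local_minimizer (objective \<Psi> y \<rho>) x"
proof (rule local_minimizer_if_excess_bounds[OF unit smallest_sv_coercive[OF sv]])
  fix i assume "i \<in> A"
  have "convex_on (ball (x $ i) 1) (\<lambda>u. \<rho> u + \<kappa> / 2 * u\<^sup>2)"
    by (rule convex_on_subset[OF conv]) auto
  then show "\<forall>\<^sub>F s in nhds 0.
      - (\<kappa> / 2 * s\<^sup>2) \<le> penalty_excess \<rho> (dual_vector \<Psi> y x $ i) (x $ i) s"
    using coordinatewise_minimizer_excess[OF unit min]
    by (intro excess_lower_bound_if_weakly_convex[where \<epsilon> = 1]) auto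
next
  fix i assume i: "i \<notin> A"
  then have "x $ i = 0" by (simp add: A active_set_def)
  have "\<bar>dual_vector \<Psi> y x $ i\<bar> < lam"
    using dual component_le_infnorm_cart[of "\<chi> i. if i \<in> - A then dual_vector \<Psi> y x $ i else 0" i] i
    by (simp add: infnorm_on_def)
  from excess_at_zero_if_steep[OF zero this steep] \<open>x $ i = 0\<close>
  show "\<exists>c>0. \<forall>\<^sub>F s in nhds 0.
      c * \<bar>s\<bar> \<le> penalty_excess \<rho> (dual_vector \<Psi> y x $ i) (x $ i) s"
    by simp
qed

theorem theorem3p1:
  fixes \<Psi> :: "real^'p^'n" and y :: "real^'n" and lam \<tau> :: real
    and x :: "real^'p" and d :: "real^'p" and A I :: "'p set"
  assumes unit_columns: "\<And>i. norm (column i \<Psi>) = 1"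
    and lambda_pos: "lam > 0"
    and A: "A = active_set x"
    and I: "I = - A"
    and d: "d = dual_vector \<Psi> y x"
  shows
    "(coordinatewise_minimizer (objective \<Psi> y (pen_l0 lam)) x
        \<longrightarrow> local_minimizer (objective \<Psi> y (pen_l0 lam)) x)
   \<and> (0 < \<tau> \<and> \<tau> < 1
        \<and> coordinatewise_minimizer (objective \<Psi> y (pen_bridge lam \<tau>)) x
        \<and> smallest_sv \<Psi> A > ereal (\<tau> / 2)
        \<longrightarrow> local_minimizer (objective \<Psi> y (pen_bridge lam \<tau>)) x)
   \<and> (\<tau> > 1 / 2
        \<and> coordinatewise_minimizer (objective \<Psi> y (pen_capped lam \<tau>)) x
        \<and> {i. \<bar>x $ i\<bar> = lam * \<tau>} = {}
        \<longrightarrow> local_minimizer (objective \<Psi> y (pen_capped lam \<tau>)) x)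
   \<and> (\<tau> > 2
        \<and> coordinatewise_minimizer (objective \<Psi> y (pen_scad lam \<tau>)) x
        \<and> smallest_sv \<Psi> A > ereal (1 / (\<tau> - 1))
        \<and> infnorm_on I d < lam
        \<longrightarrow> local_minimizer (objective \<Psi> y (pen_scad lam \<tau>)) x)
   \<and> (\<tau> > 1
        \<and> coordinatewise_minimizer (objective \<Psi> y (pen_mcp lam \<tau>)) x
        \<and> smallest_sv \<Psi> A > ereal (1 / \<tau>)
        \<and> infnorm_on I d < lam
        \<longrightarrow> local_minimizer (objective \<Psi> y (pen_mcp lam \<tau>)) x)"
proof (intro conjI impI; (elim conjE)?)
  assume min: "coordinatewise_minimizer (objective \<Psi> y (pen_l0 lam)) x"
  show "local_minimizer (objective \<Psi> y (pen_l0 lam)) x"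
  proof (rule local_minimizer_if_excess_nonneg)
    fix i
    show "\<forall>\<^sub>F s in nhds 0. 0 \<le> penalty_excess (pen_l0 lam) (dual_vector \<Psi> y x $ i) (x $ i) s"
    proof (cases "x $ i = 0")
      case True
      then show ?thesis using l0_excess_nonneg_at_zero[OF lambda_pos] by simp
    next
      case False
      then show ?thesis
        using excess_lower_bound_if_weakly_convex[OF
            coordinatewise_minimizer_excess[OF unit_columns min] _ l0_convex_near_active[OF False]]
        by simp
    qed
  qed
next
  assume \<tau>: "0 < \<tau>" "\<tau> < 1"
    and min: "coordinatewise_minimizer (objective \<Psi> y (pen_bridge lam \<tau>)) x"
    and sv: "ereal (\<tau> / 2) < smallest_sv \<Psi> A"
  obtain \<kappa> where \<kappa>: "\<tau> / 2 < \<kappa>" "ereal \<kappa> < smallest_sv \<Psi> A"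
    using ereal_dense2[OF sv] by auto
  show "local_minimizer (objective \<Psi> y (pen_bridge lam \<tau>)) x"
  proof (rule local_minimizer_if_excess_bounds[OF unit_columns smallest_sv_coercive[OF \<kappa>(2)]])
    fix i assume "i \<in> A"
    then have "x $ i \<noteq> 0" by (simp add: A active_set_def)
    note coord = coordinatewise_minimizer_excess[OF unit_columns min, of _ i]
    obtain \<epsilon> where \<epsilon>: "\<epsilon> > 0" "convex_on (ball (x $ i) \<epsilon>) (\<lambda>u. pen_bridge lam \<tau> u + \<kappa> / 2 * u\<^sup>2)"
      using bridge_weakly_convex_near_minimizer[OF \<tau> lambda_pos \<open>x $ i \<noteq> 0\<close> coord \<kappa>(1)] by blast
    show "\<forall>\<^sub>F s in nhds 0.
        - (\<kappa> / 2 * s\<^sup>2) \<le> penalty_excess (pen_bridge lam \<tau>) (dual_vector \<Psi> y x $ i) (x $ i) s"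
      by (rule excess_lower_bound_if_weakly_convex[OF coord \<epsilon>])
  next
    fix i assume "i \<notin> A"
    then have "x $ i = 0" by (simp add: A active_set_def)
    with bridge_excess_at_zero[OF \<tau> lambda_pos, of "dual_vector \<Psi> y x $ i"]
    show "\<exists>c>0. \<forall>\<^sub>F s in nhds 0.
        c * \<bar>s\<bar> \<le> penalty_excess (pen_bridge lam \<tau>) (dual_vector \<Psi> y x $ i) (x $ i) s"
      by (intro exI[of _ 1]) simp
  qed
next
  assume \<tau>: "1 / 2 < \<tau>"
    and min: "coordinatewise_minimizer (objective \<Psi> y (pen_capped lam \<tau>)) x"
    and off: "{i. \<bar>x $ i\<bar> = lam * \<tau>} = {}"
  show "local_minimizer (objective \<Psi> y (pen_capped lam \<tau>)) x"
  proof (rule local_minimizer_if_excess_nonneg)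
    fix i
    have "\<tau> > 0" "\<bar>x $ i\<bar> \<noteq> lam * \<tau>" using \<tau> off by auto
    then obtain \<epsilon> where \<epsilon>: "\<epsilon> > 0" "convex_on (ball (x $ i) \<epsilon>) (\<lambda>u. pen_capped lam \<tau> u + 0 / 2 * u\<^sup>2)"
      using capped_convex_off_knots[OF lambda_pos] by blast
    show "\<forall>\<^sub>F s in nhds 0. 0 \<le> penalty_excess (pen_capped lam \<tau>) (dual_vector \<Psi> y x $ i) (x $ i) s"
      using excess_lower_bound_if_weakly_convex[OF
          coordinatewise_minimizer_excess[OF unit_columns min] \<epsilon>]
      by simp
  qed
next
  assume \<tau>: "2 < \<tau>"
    and min: "coordinatewise_minimizer (objective \<Psi> y (pen_scad lam \<tau>)) x"
    and sv: "ereal (1 / (\<tau> - 1)) < smallest_sv \<Psi> A"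
    and dual: "infnorm_on I d < lam"
  show "local_minimizer (objective \<Psi> y (pen_scad lam \<tau>)) x"
  proof (rule local_minimizer_if_weakly_convex_steep[OF unit_columns min sv A])
    show "convex_on UNIV (\<lambda>u. pen_scad lam \<tau> u + (1 / (\<tau> - 1)) / 2 * u\<^sup>2)"
      using \<tau> by (intro convex_on_scad lambda_pos) simp
    show "\<forall>\<^sub>F s in nhds 0. lam * \<bar>s\<bar> - 0 * s\<^sup>2 \<le> pen_scad lam \<tau> s"
      using \<tau> by (intro scad_steep_at_zero lambda_pos) simp
  qed (use dual lambda_pos \<tau> in \<open>auto simp: I d pen_scad_def mult_less_0_iff\<close>)
next
  assume \<tau>: "1 < \<tau>"
    and min: "coordinatewise_minimizer (objective \<Psi> y (pen_mcp lam \<tau>)) x"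
    and sv: "ereal (1 / \<tau>) < smallest_sv \<Psi> A"
    and dual: "infnorm_on I d < lam"
  show "local_minimizer (objective \<Psi> y (pen_mcp lam \<tau>)) x"
  proof (rule local_minimizer_if_weakly_convex_steep[OF unit_columns min sv A])
    show "convex_on UNIV (\<lambda>u. pen_mcp lam \<tau> u + (1 / \<tau>) / 2 * u\<^sup>2)"
      using \<tau> by (intro convex_on_mcp lambda_pos) simp
    show "\<forall>\<^sub>F s in nhds 0. lam * \<bar>s\<bar> - 1 / (2 * \<tau>) * s\<^sup>2 \<le> pen_mcp lam \<tau> s"
      using \<tau> by (intro mcp_steep_at_zero lambda_pos) simp
  qed (use dual lambda_pos \<tau> in \<open>auto simp: I d pen_mcp_def\<close>)
qed

end
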